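(* Let $\hat\alpha\in\mathbb{R}^n$ and let $\mathcal{A}=\mathcal{S}_n\cdot\hat\alpha$ be its orbit. Let $\hat\beta_1,\ldots,\hat\beta_m\in\mathbb{R}^n$ be such that $\hat\beta_i\in\operatorname{int}(\operatorname{conv}(\mathcal{A}\cup\{0\}))$ for $1\le i\le m$ and such that $\hat\beta_1,\ldots,\hat\beta_m$ lie in pairwise distinct orbits under $\mathcal{S}_n$. Put $\mathcal{B}_i=\mathcal{S}_n\cdot\hat\beta_i$ and let $$f(x)=c\sum_{\alpha\in\mathcal{A}}\exp(\langle\alpha,x\rangle)-\sum_{i=1}^m d_i\sum_{\beta\in\mathcal{B}_i}\exp(\langle\beta,x\rangle)+w$$ with $c>0$, $d_1,\ldots,d_m>0$ and $w\in\mathbb{R}$. Then $f^*=f^{\mathrm{SAGE}}$.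
   Context: The symmetric group $\mathcal{S}_n$ acts on $\mathbb{R}^n$ by permuting coordinates; $\mathcal{S}_n\cdot\alpha$ is the orbit of $\alpha$. $\langle\cdot,\cdot\rangle$ is the standard inner product on $\mathbb{R}^n$. For a finite set $\mathcal{A}'\subset\mathbb{R}^n$ and $\beta\in\mathbb{R}^n\setminus\mathcal{A}'$, $C_{\mathrm{AGE}}(\mathcal{A}',\beta)$ is the set of signomials $\sum_{\alpha\in\mathcal{A}'}c_\alpha e^{\langle\alpha,x\rangle}+c_\beta e^{\langle\beta,x\rangle}$ with $c_\alpha\ge 0$ for $\alpha\in\mathcal{A}'$, $c_\beta\in\mathbb{R}$, that are nonnegative for all $x\in\mathbb{R}^n$. For a nonempty finite set $\mathcal{T}\subset\mathbb{R}^n$, the SAGE cone is the Minkowski sum $C_{\mathrm{SAGE}}(\mathcal{T})=\sum_{\beta\in\mathcal{T}}C_{\mathrm{AGE}}(\mathcal{T}\setminus\{\beta\},\beta)$. For a signomial $f$, $f^*=\inf_{x\in\mathbb{R}^n}f(x)$, and $f^{\mathrm{SAGE}}=\sup\{\lambda\in\mathbb{R}: f-\lambda\in C_{\mathrm{SAGE}}(\mathcal{T})\}$, where $\mathcal{T}$ is the set of exponents occurring in $f$ together with $0$ (here $\mathcal{T}=\mathcal{A}\cup\bigcup_i\mathcal{B}_i\cup\{0\}$). *)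

theory Defs
  imports "HOL-Analysis.Analysis"
begin

definition permute_coords :: "('n \<Rightarrow> 'n) \<Rightarrow> real ^ 'n \<Rightarrow> real ^ 'n" where
  "permute_coords p v = (\<chi> i. v $ inv p i)"

definition sym_orbit :: "real ^ 'n \<Rightarrow> (real ^ 'n) set" where
  "sym_orbit v = {permute_coords p v | p. p permutes (UNIV :: 'n set)}"

text \<open>Signomials are represented as functions on \<open>\<real>\<^sup>n\<close>; since the functions
  \<open>exp (\<alpha> \<bullet> x)\<close> with distinct exponents are linearly independent, this loses no information.
  The intended use is for finite \<open>A\<close> and \<open>\<beta> \<notin> A\<close>.\<close>

definition C_AGE :: "(real ^ 'n) set \<Rightarrow> real ^ 'n \<Rightarrow> (real ^ 'n \<Rightarrow> real) set" where
  "C_AGE A \<beta> = {f. (\<exists>c b. (\<forall>\<alpha>\<in>A. 0 \<le> c \<alpha>) \<and>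
      f = (\<lambda>x. (\<Sum>\<alpha>\<in>A. c \<alpha> * exp (\<alpha> \<bullet> x)) + b * exp (\<beta> \<bullet> x))) \<and> (\<forall>x. 0 \<le> f x)}"

definition C_SAGE :: "(real ^ 'n) set \<Rightarrow> (real ^ 'n \<Rightarrow> real) set" where
  "C_SAGE T = {\<lambda>x. \<Sum>\<beta>\<in>T. g \<beta> x | g. \<forall>\<beta>\<in>T. g \<beta> \<in> C_AGE (T - {\<beta>}) \<beta>}"

text \<open>Both bounds are extended reals, so that they are meaningful also when the infimum is
  \<open>-\<infinity>\<close> or no \<open>\<lambda>\<close> is feasible. The exponent set \<open>T\<close> is an explicit argument of
  the SAGE bound, because \<open>f\<close> is only a function.\<close>

definition global_inf :: "(real ^ 'n \<Rightarrow> real) \<Rightarrow> ereal" where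
  "global_inf f = (INF x. ereal (f x))"

definition sage_bound :: "(real ^ 'n) set \<Rightarrow> (real ^ 'n \<Rightarrow> real) \<Rightarrow> ereal" where
  "sage_bound T f = (SUP l \<in> {l. (\<lambda>x. f x - l) \<in> C_SAGE T}. ereal l)"

end

theory Submission
  imports Defs
begin

text \<open>
  Signomials in the SAGE cone are nonnegative, so the SAGE bound never exceeds the infimum. It
  is exact as soon as \<open>f - f(x\<^sub>0)\<close> lies in the cone for one point \<open>x\<^sub>0\<close>. When negative terms
  are present, such an \<open>x\<^sub>0\<close> exists on the diagonal \<open>\<real>(1,\<dots>,1)\<close>, and the certificate at
  \<open>x\<^sub>0\<close> is a sum of weighted AM/GM inequalities that are all tight at \<open>x\<^sub>0\<close>.

  Let \<open>s\<close> be the coordinate sum of \<open>\<alpha>h\<close>. The orbit \<open>A\<close> lies in the hyperplane of vectors with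
  coordinate sum \<open>s\<close>. Hence an interior point of \<open>conv (A \<union> {0})\<close> can only exist if
  \<open>s \<noteq> 0\<close>, and then the coordinate sum of \<open>\<beta>h i\<close> is \<open>\<theta>\<^sub>i s\<close> with \<open>0 < \<theta>\<^sub>i < 1\<close>
  (\<open>interior_hull_orbit\<close>). In particular the exponents of \<open>B i\<close> avoid \<open>A\<close> and \<open>0\<close>.

  Write \<open>\<beta> \<in> B i\<close> as \<open>\<beta> = \<Sum>\<alpha>. \<nu>\<^sub>\<beta>(\<alpha>) \<alpha>\<close> with nonnegative weights of total \<open>\<theta>\<^sub>i\<close>, the
  missing mass \<open>1 - \<theta>\<^sub>i\<close> sitting at the exponent \<open>0\<close>. AM/GM (\<open>weighted_exp_le\<close>), translated so
  that equality holds at \<open>x\<^sub>0 = (v/s)(1,\<dots>,1)\<close>, bounds \<open>d\<^sub>i exp (\<beta> \<bullet> x)\<close> by a nonnegative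
  combination of the \<open>exp (\<alpha> \<bullet> x)\<close> and a constant. The difference \<open>h\<^sub>\<beta>\<close> is an AGE signomial.
  It remains to see that the sum of all \<open>h\<^sub>\<beta>\<close> is \<open>f\<close> up to a constant, i.e. that each
  \<open>exp (\<alpha> \<bullet> x)\<close> receives exactly the coefficient \<open>c\<close>. Two facts give this:

  \<^item> the weights can be averaged over the symmetric group so that every \<open>\<alpha>\<close> receives the same
    total from the orbit \<open>B i\<close>, namely \<open>\<theta>\<^sub>i |B i| / |A|\<close> (\<open>balanced_weights\<close>);
  \<^item> \<open>v\<close> can be chosen so that the common coefficient is \<open>c\<close>; this is the equation
    \<open>\<Sum>i. d\<^sub>i |B i| \<theta>\<^sub>i exp (-(1 - \<theta>\<^sub>i) v) = c |A|\<close>, the critical point equation of \<open>f\<close> on the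
    diagonal, solved by the intermediate value theorem (\<open>exp_sum_attains\<close>).

  Since every \<open>h\<^sub>\<beta>\<close> vanishes at \<open>x\<^sub>0\<close>, the constant is \<open>f(x\<^sub>0)\<close>.

  Without negative terms both \<open>s = 0\<close> and \<open>s \<noteq> 0\<close> occur, and for \<open>s \<noteq> 0\<close> the infimum is not
  attained. This case is elementary (\<open>exact_without_negative_terms\<close>).
\<close>

section \<open>The action of the symmetric group\<close>

lemma permute_coords_compose:
  fixes v :: "real ^ 'n"
  assumes "p permutes (UNIV :: 'n set)" "q permutes (UNIV :: 'n set)"
  shows "permute_coords p (permute_coords q v) = permute_coords (p \<circ> q) v"
  using assms by (simp add: permute_coords_def o_inv_distrib permutes_bij)

lemma permute_coords_inverse:
  fixes v :: "real ^ 'n"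
  assumes "p permutes (UNIV :: 'n set)"
  shows "permute_coords (inv p) (permute_coords p v) = v"
    and "permute_coords p (permute_coords (inv p) v) = v"
  using assms by (simp_all add: permute_coords_def permutes_inv_inv permutes_inverses)

lemma linear_permute_coords: "linear (permute_coords p)"
  by (rule linearI) (simp_all add: permute_coords_def vec_eq_iff)

lemma inner_one_permute_coords:
  fixes v :: "real ^ 'n"
  assumes "p permutes (UNIV :: 'n set)"
  shows "permute_coords p v \<bullet> 1 = v \<bullet> 1"
proof -
  have "(\<Sum>i\<in>UNIV. v $ inv p i) = (\<Sum>i\<in>UNIV. v $ i)"
    using sum.permute[OF permutes_inv[OF assms], of "\<lambda>i. v $ i"] by (simp add: o_def)
  then show ?thesis by (simp add: permute_coords_def inner_vec_def)
qed

lemma inner_one_sym_orbit: "u \<in> sym_orbit v \<Longrightarrow> u \<bullet> 1 = v \<bullet> 1"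
  by (auto simp: sym_orbit_def inner_one_permute_coords)

lemma sym_orbit_eq_image:
  "sym_orbit v = (\<lambda>p. permute_coords p v) ` {p. p permutes (UNIV :: 'n set)}"
  for v :: "real ^ 'n"
  by (auto simp: sym_orbit_def)

lemma finite_sym_orbit [simp]: "finite (sym_orbit v)"
  by (simp add: sym_orbit_eq_image finite_permutations)

lemma self_in_sym_orbit: "v \<in> sym_orbit v"
  unfolding sym_orbit_def by (auto intro!: exI[of _ id] simp: permutes_id permute_coords_def)

lemma card_sym_orbit_pos: "card (sym_orbit v) > 0"
  using self_in_sym_orbit by (metis card_gt_0_iff empty_iff finite_sym_orbit)

lemma permute_coords_in_sym_orbit:
  fixes u v :: "real ^ 'n"
  assumes "p permutes (UNIV :: 'n set)" "u \<in> sym_orbit v"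
  shows "permute_coords p u \<in> sym_orbit v"
  using assms by (auto simp: sym_orbit_def permute_coords_compose intro: permutes_compose)

lemma sym_orbit_sym:
  fixes u v :: "real ^ 'n"
  assumes "u \<in> sym_orbit v"
  shows "v \<in> sym_orbit u"
proof -
  obtain p where p: "p permutes (UNIV :: 'n set)" "u = permute_coords p v"
    using assms by (auto simp: sym_orbit_def)
  then have "v = permute_coords (inv p) u" by (simp add: permute_coords_inverse)
  with p show ?thesis by (auto simp: sym_orbit_def intro: permutes_inv)
qed

lemma sym_orbit_eqI:
  fixes u v :: "real ^ 'n"
  assumes "u \<in> sym_orbit v"
  shows "sym_orbit u = sym_orbit v"
proof -
  have "sym_orbit a \<subseteq> sym_orbit b" if "a \<in> sym_orbit b" for a b :: "real ^ 'n"
    using that permute_coords_in_sym_orbit[OF _ that] by (auto simp: sym_orbit_def[of a])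
  with assms sym_orbit_sym[OF assms] show ?thesis by blast
qed

lemma bij_betw_permute_coords:
  fixes v :: "real ^ 'n"
  assumes p: "p permutes (UNIV :: 'n set)"
  shows "bij_betw (permute_coords p) (sym_orbit v) (sym_orbit v)"
  by (rule bij_betw_byWitness[where f' = "permute_coords (inv p)"])
     (use p in \<open>auto simp: permute_coords_inverse permutes_inv permute_coords_in_sym_orbit\<close>)

lemma sum_sym_orbit_permute:
  fixes v :: "real ^ 'n"
  assumes p: "p permutes (UNIV :: 'n set)"
  shows "(\<Sum>u\<in>sym_orbit v. F (permute_coords p u)) = sum F (sym_orbit v)"
  by (rule sum.reindex_bij_betw[OF bij_betw_permute_coords[OF p]])

text \<open>Instead of counting stabilisers: the sum over the group does not depend on the
  choice of \<open>u\<close> in the orbit, so its value follows by summing it over the whole orbit.\<close>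

lemma sum_permutations_orbit:
  fixes u v :: "real ^ 'n" and F :: "real ^ 'n \<Rightarrow> real"
  assumes u: "u \<in> sym_orbit v"
  shows "card (sym_orbit v) * (\<Sum>p | p permutes (UNIV :: 'n set). F (permute_coords p u))
    = card {p. p permutes (UNIV :: 'n set)} * sum F (sym_orbit v)"
proof -
  let ?P = "{p. p permutes (UNIV :: 'n set)}"
  have const: "(\<Sum>p\<in>?P. F (permute_coords p y)) = (\<Sum>p\<in>?P. F (permute_coords p u))"
    if y: "y \<in> sym_orbit v" for y
  proof -
    have "y \<in> sym_orbit u" using sym_orbit_eqI[OF u] y by simp
    then obtain q where q: "q permutes (UNIV :: 'n set)" "y = permute_coords q u"
      by (auto simp: sym_orbit_def)
    have "(\<Sum>p\<in>?P. F (permute_coords p u)) = (\<Sum>p\<in>?P. F (permute_coords (p \<circ> q) u))"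
      by (rule sum_permutations_compose_right[OF q(1)])
    also have "\<dots> = (\<Sum>p\<in>?P. F (permute_coords p y))"
      using q by (intro sum.cong) (simp_all add: permute_coords_compose)
    finally show ?thesis ..
  qed
  have "card (sym_orbit v) * (\<Sum>p\<in>?P. F (permute_coords p u))
      = (\<Sum>y\<in>sym_orbit v. \<Sum>p\<in>?P. F (permute_coords p y))"
    using const by simp
  also have "\<dots> = (\<Sum>p\<in>?P. \<Sum>y\<in>sym_orbit v. F (permute_coords p y))"
    by (rule sum.swap)
  also have "\<dots> = (\<Sum>p\<in>?P. sum F (sym_orbit v))"
    by (intro sum.cong refl sum_sym_orbit_permute) simp
  finally show ?thesis by simp
qed

section \<open>Balanced barycentric coordinates\<close>

lemma hull_orbit_permute:
  fixes v :: "real ^ 'n"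
  assumes p: "p permutes (UNIV :: 'n set)" and b: "b \<in> convex hull (sym_orbit v \<union> {0})"
  shows "permute_coords p b \<in> convex hull (sym_orbit v \<union> {0})"
proof -
  have "permute_coords p ` (sym_orbit v \<union> {0}) \<subseteq> sym_orbit v \<union> {0}"
    using permute_coords_in_sym_orbit[OF p] linear_0[OF linear_permute_coords[of p]] by auto
  then have "permute_coords p ` (convex hull (sym_orbit v \<union> {0})) \<subseteq> convex hull (sym_orbit v \<union> {0})"
    by (simp add: convex_hull_linear_image[OF linear_permute_coords] hull_mono)
  with b show ?thesis by blast
qed

text \<open>The weight at \<open>0\<close> contributes nothing to \<open>b\<close> and is dropped. The total of the other
  weights is forced by comparing coordinate sums, as these agree on the whole orbit.\<close>

lemma barycentric_weights:
  fixes v b :: "real ^ 'n"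
  assumes s: "v \<bullet> 1 \<noteq> 0" and b: "b \<in> convex hull (sym_orbit v \<union> {0})"
  shows "\<exists>\<mu>. (\<forall>a\<in>sym_orbit v. 0 \<le> \<mu> a) \<and> (\<Sum>a\<in>sym_orbit v. \<mu> a *\<^sub>R a) = b \<and>
    (\<Sum>a\<in>sym_orbit v. \<mu> a) = (b \<bullet> 1) / (v \<bullet> 1)"
proof -
  have 0: "0 \<notin> sym_orbit v" using s inner_one_sym_orbit[of 0 v] by auto
  obtain u where u: "\<forall>x\<in>insert 0 (sym_orbit v). 0 \<le> u x"
    "(\<Sum>x\<in>insert 0 (sym_orbit v). u x *\<^sub>R x) = b"
    using b by (auto simp: convex_hull_finite)
  have eq: "(\<Sum>a\<in>sym_orbit v. u a *\<^sub>R a) = b" using u(2) 0 by simp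
  then have "b \<bullet> 1 = (\<Sum>a\<in>sym_orbit v. u a * (a \<bullet> 1))"
    by (auto simp: inner_sum_left)
  also have "\<dots> = (\<Sum>a\<in>sym_orbit v. u a) * (v \<bullet> 1)"
    by (simp add: sum_distrib_right inner_one_sym_orbit)
  finally show ?thesis using u(1) eq s by (intro exI[of _ u]) auto
qed

text \<open>Choose barycentric weights \<open>\<mu> b\<close> for each \<open>b\<close> of the orbit arbitrarily and average: the
  weights \<open>\<lambda>a. \<mu> (p b) (p a)\<close> represent \<open>p\<^sup>-\<^sup>1 (p b) = b\<close> again, so their mean \<open>\<nu> b\<close> over all
  permutations \<open>p\<close> still represents \<open>b\<close>. The sum of \<open>\<nu> b a\<close> over \<open>b\<close> is then a group average
  of a function of \<open>a\<close> and hence the same for all \<open>a\<close> in the orbit, which is what the final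
  equation says.\<close>

lemma balanced_weights:
  fixes v b0 :: "real ^ 'n" and \<theta> :: real
  assumes s: "v \<bullet> 1 \<noteq> 0" and b0: "b0 \<in> convex hull (sym_orbit v \<union> {0})"
    and \<theta>_def: "\<theta> = (b0 \<bullet> 1) / (v \<bullet> 1)"
  shows "\<exists>\<nu> :: real ^ 'n \<Rightarrow> real ^ 'n \<Rightarrow> real. (\<forall>b\<in>sym_orbit b0. (\<forall>a\<in>sym_orbit v. 0 \<le> \<nu> b a) \<and>
        (\<Sum>a\<in>sym_orbit v. \<nu> b a *\<^sub>R a) = b \<and> (\<Sum>a\<in>sym_orbit v. \<nu> b a) = \<theta>) \<and>
      (\<forall>a\<in>sym_orbit v. card (sym_orbit v) * (\<Sum>b\<in>sym_orbit b0. \<nu> b a) = \<theta> * card (sym_orbit b0))"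
proof -
  let ?P = "{p. p permutes (UNIV :: 'n set)}" and ?A = "sym_orbit v" and ?B = "sym_orbit b0"
  define N where "N = real (card ?P)"
  have "card ?P > 0" using permutes_id finite_permutations[of "UNIV :: 'n set"]
    by (auto simp: card_gt_0_iff intro: exI[of _ id])
  then have N: "N > 0" by (simp add: N_def)
  have "\<exists>\<mu>. (\<forall>a\<in>?A. 0 \<le> \<mu> a) \<and> (\<Sum>a\<in>?A. \<mu> a *\<^sub>R a) = b \<and> (\<Sum>a\<in>?A. \<mu> a) = \<theta>" if b: "b \<in> ?B" for b
  proof -
    have "b \<in> convex hull (?A \<union> {0})"
      using b hull_orbit_permute[OF _ b0] by (auto simp: sym_orbit_def)
    from barycentric_weights[OF s this] show ?thesis
      by (simp add: \<theta>_def inner_one_sym_orbit[OF b])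
  qed
  then obtain \<mu> where \<mu>: "\<And>b a. b \<in> ?B \<Longrightarrow> a \<in> ?A \<Longrightarrow> 0 \<le> \<mu> b a"
    "\<And>b. b \<in> ?B \<Longrightarrow> (\<Sum>a\<in>?A. \<mu> b a *\<^sub>R a) = b" "\<And>b. b \<in> ?B \<Longrightarrow> (\<Sum>a\<in>?A. \<mu> b a) = \<theta>"
    by metis
  define \<nu> where "\<nu> b a = (\<Sum>p\<in>?P. \<mu> (permute_coords p b) (permute_coords p a)) / N" for b a
  have "0 \<le> \<nu> b a" if "b \<in> ?B" "a \<in> ?A" for b a
    unfolding \<nu>_def using N that
    by (intro divide_nonneg_pos sum_nonneg) (auto intro: \<mu>(1) permute_coords_in_sym_orbit)
  moreover have "(\<Sum>a\<in>?A. \<nu> b a *\<^sub>R a) = b" if b: "b \<in> ?B" for b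
  proof -
    have p: "(\<Sum>a\<in>?A. \<mu> (permute_coords p b) (permute_coords p a) *\<^sub>R a) = b" if p: "p \<in> ?P" for p
    proof -
      let ?q = "permute_coords (inv p)"
      have "(\<Sum>a\<in>?A. \<mu> (permute_coords p b) (permute_coords p a) *\<^sub>R a)
          = (\<Sum>a\<in>?A. \<mu> (permute_coords p b) (permute_coords p a) *\<^sub>R ?q (permute_coords p a))"
        using p by (simp add: permute_coords_inverse)
      also have "\<dots> = (\<Sum>a\<in>?A. \<mu> (permute_coords p b) a *\<^sub>R ?q a)"
        using p by (intro sum_sym_orbit_permute) simp
      also have "\<dots> = ?q (\<Sum>a\<in>?A. \<mu> (permute_coords p b) a *\<^sub>R a)"
        by (simp add: linear_sum[OF linear_permute_coords] linear_scale[OF linear_permute_coords])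
      also have "\<dots> = b"
        using p b by (simp add: \<mu>(2) permute_coords_in_sym_orbit permute_coords_inverse)
      finally show ?thesis .
    qed
    have "N *\<^sub>R (\<Sum>a\<in>?A. \<nu> b a *\<^sub>R a)
        = (\<Sum>a\<in>?A. \<Sum>p\<in>?P. \<mu> (permute_coords p b) (permute_coords p a) *\<^sub>R a)"
      using N by (simp add: \<nu>_def scaleR_sum_right scaleR_sum_left)
    also have "\<dots> = (\<Sum>p\<in>?P. \<Sum>a\<in>?A. \<mu> (permute_coords p b) (permute_coords p a) *\<^sub>R a)"
      by (rule sum.swap)
    also have "\<dots> = (\<Sum>p\<in>?P. b)" using p by (intro sum.cong) auto
    also have "\<dots> = N *\<^sub>R b" by (simp add: N_def sum_constant_scaleR del: sum_constant)
    finally show ?thesis using N by simp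
  qed
  moreover have "(\<Sum>a\<in>?A. \<nu> b a) = \<theta>" if b: "b \<in> ?B" for b
  proof -
    have "(\<Sum>a\<in>?A. \<nu> b a) = (\<Sum>a\<in>?A. \<Sum>p\<in>?P. \<mu> (permute_coords p b) (permute_coords p a)) / N"
      by (simp add: \<nu>_def sum_divide_distrib)
    also have "\<dots> = (\<Sum>p\<in>?P. \<Sum>a\<in>?A. \<mu> (permute_coords p b) (permute_coords p a)) / N"
      by (subst sum.swap) simp
    also have "\<dots> = (\<Sum>p\<in>?P. \<theta>) / N"
      using b by (intro arg_cong2[of _ _ _ _ "(/)"] sum.cong refl)
        (simp add: sum_sym_orbit_permute \<mu>(3) permute_coords_in_sym_orbit)
    also have "\<dots> = \<theta>" using N by (simp flip: N_def)
    finally show ?thesis .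
  qed
  moreover have "card ?A * (\<Sum>b\<in>?B. \<nu> b a) = \<theta> * card ?B" if a: "a \<in> ?A" for a
  proof -
    have "(\<Sum>b\<in>?B. \<nu> b a) = (\<Sum>b\<in>?B. \<Sum>p\<in>?P. \<mu> (permute_coords p b) (permute_coords p a)) / N"
      by (simp add: \<nu>_def sum_divide_distrib)
    also have "\<dots> = (\<Sum>p\<in>?P. \<Sum>b\<in>?B. \<mu> (permute_coords p b) (permute_coords p a)) / N"
      by (subst sum.swap) simp
    also have "\<dots> = (\<Sum>p\<in>?P. \<Sum>b\<in>?B. \<mu> b (permute_coords p a)) / N"
    proof -
      have "(\<Sum>b\<in>?B. \<mu> (permute_coords p b) (permute_coords p a)) = (\<Sum>b\<in>?B. \<mu> b (permute_coords p a))"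
        if "p \<in> ?P" for p
        using that by (intro sum_sym_orbit_permute[where F = "\<lambda>b. \<mu> b (permute_coords p a)"]) simp
      then show ?thesis by simp
    qed
    also have "\<dots> = (\<Sum>b\<in>?B. \<Sum>p\<in>?P. \<mu> b (permute_coords p a)) / N"
      by (subst sum.swap) simp
    finally have "card ?A * (\<Sum>b\<in>?B. \<nu> b a)
        = (\<Sum>b\<in>?B. card ?A * (\<Sum>p\<in>?P. \<mu> b (permute_coords p a))) / N"
      by (simp add: sum_distrib_left)
    also have "\<dots> = (\<Sum>b\<in>?B. N * \<theta>) / N"
      by (simp add: sum_permutations_orbit[OF a] \<mu>(3) N_def)
    also have "\<dots> = \<theta> * card ?B" using N by simp
    finally show ?thesis .
  qed
  ultimately show ?thesis by (intro exI[of _ \<nu>]) blast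
qed

section \<open>Membership in the SAGE cone\<close>

text \<open>Coefficients given on a part \<open>S\<close> of the admissible exponents are extended by zero.\<close>

lemma C_AGE_I:
  fixes S T :: "(real ^ 'n) set"
  assumes "finite T" "S \<subseteq> T - {\<beta>}" "\<And>a. a \<in> S \<Longrightarrow> 0 \<le> k a"
    and "\<And>x. 0 \<le> (\<Sum>a\<in>S. k a * exp (a \<bullet> x)) + b * exp (\<beta> \<bullet> x)"
  shows "(\<lambda>x. (\<Sum>a\<in>S. k a * exp (a \<bullet> x)) + b * exp (\<beta> \<bullet> x)) \<in> C_AGE (T - {\<beta>}) \<beta>"
proof -
  let ?k = "\<lambda>a. if a \<in> S then k a else 0"
  have "(\<Sum>a\<in>S. k a * exp (a \<bullet> x)) = (\<Sum>a\<in>T - {\<beta>}. ?k a * exp (a \<bullet> x))" for x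
    using assms by (intro sum.mono_neutral_cong_left) auto
  then show ?thesis
    unfolding C_AGE_def using assms(3,4) by (intro CollectI conjI exI[of _ ?k] exI[of _ b]) auto
qed

lemma C_SAGE_I:
  fixes S T :: "(real ^ 'n) set"
  assumes "finite T" "S \<subseteq> T" "\<And>\<beta>. \<beta> \<in> S \<Longrightarrow> g \<beta> \<in> C_AGE (T - {\<beta>}) \<beta>"
  shows "(\<lambda>x. \<Sum>\<beta>\<in>S. g \<beta> x) \<in> C_SAGE T"
proof -
  let ?g = "\<lambda>\<beta>. if \<beta> \<in> S then g \<beta> else (\<lambda>x. 0)"
  have "(\<lambda>x. 0) \<in> C_AGE (T - {\<beta>}) \<beta>" for \<beta>
    using C_AGE_I[of T "{}" \<beta> _ 0] assms(1) by simp
  then have "\<forall>\<beta>\<in>T. ?g \<beta> \<in> C_AGE (T - {\<beta>}) \<beta>" using assms(3) by simp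
  moreover have "(\<Sum>\<beta>\<in>S. g \<beta> x) = (\<Sum>\<beta>\<in>T. ?g \<beta> x)" for x
    using assms by (intro sum.mono_neutral_cong_left) auto
  ultimately show ?thesis unfolding C_SAGE_def by (intro CollectI exI[of _ ?g]) auto
qed

lemma C_SAGE_nonneg:
  fixes T :: "(real ^ 'n) set"
  shows "g \<in> C_SAGE T \<Longrightarrow> 0 \<le> g x"
  by (auto simp: C_SAGE_def C_AGE_def intro!: sum_nonneg)

lemma sage_bound_le_global_inf: "sage_bound T f \<le> global_inf f"
  unfolding sage_bound_def global_inf_def
proof (intro SUP_least INF_greatest)
  fix l x assume "l \<in> {l. (\<lambda>x. f x - l) \<in> C_SAGE T}"
  then show "ereal l \<le> ereal (f x)" using C_SAGE_nonneg[of "\<lambda>x. f x - l" T x] by simp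
qed

lemma sage_bound_exact_at_point:
  assumes "(\<lambda>x. f x - f x0) \<in> C_SAGE T"
  shows "global_inf f = sage_bound T f"
proof (rule antisym[OF _ sage_bound_le_global_inf])
  have "global_inf f \<le> ereal (f x0)" unfolding global_inf_def by (rule INF_lower) simp
  also have "\<dots> \<le> sage_bound T f" unfolding sage_bound_def using assms by (intro SUP_upper) simp
  finally show "global_inf f \<le> sage_bound T f" .
qed

section \<open>The analytic ingredients\<close>

text \<open>Weighted AM/GM with the missing mass \<open>1 - sum \<nu> S\<close> placed at the exponent \<open>0\<close>. The weighted
  sum of the tangent line inequalities of \<open>exp\<close> at \<open>b \<bullet> y\<close> gives it, because the linear terms
  cancel.\<close>

lemma weighted_exp_le:
  fixes y b :: "'a :: real_inner"
  assumes "\<And>a. a \<in> S \<Longrightarrow> 0 \<le> \<nu> a" "(\<Sum>a\<in>S. \<nu> a *\<^sub>R a) = b" "sum \<nu> S \<le> 1"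
  shows "exp (b \<bullet> y) \<le> (\<Sum>a\<in>S. \<nu> a * exp (a \<bullet> y)) + (1 - sum \<nu> S)"
proof -
  let ?B = "b \<bullet> y"
  have tangent: "exp ?B * (1 + (z - ?B)) \<le> exp z" for z
  proof -
    have "exp ?B * (1 + (z - ?B)) \<le> exp ?B * exp (z - ?B)"
      by (intro mult_left_mono exp_ge_add_one_self) simp
    then show ?thesis by (simp flip: exp_add)
  qed
  have B: "(\<Sum>a\<in>S. \<nu> a * (a \<bullet> y)) = ?B"
    using assms(2) by (auto simp: inner_sum_left)
  have "exp ?B = exp ?B * (sum \<nu> S * (1 - ?B) + (\<Sum>a\<in>S. \<nu> a * (a \<bullet> y)) + (1 - sum \<nu> S) * (1 - ?B))"
    unfolding B by (simp add: algebra_simps)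
  also have "\<dots> = (\<Sum>a\<in>S. \<nu> a * (exp ?B * (1 + (a \<bullet> y - ?B)))) + (1 - sum \<nu> S) * (exp ?B * (1 + (0 - ?B)))"
    by (simp add: sum_distrib_left sum_distrib_right algebra_simps sum.distrib sum_subtractf)
  also have "\<dots> \<le> (\<Sum>a\<in>S. \<nu> a * exp (a \<bullet> y)) + (1 - sum \<nu> S) * exp 0"
    by (intro add_mono sum_mono mult_left_mono tangent) (use assms in auto)
  finally show ?thesis by simp
qed

text \<open>The left-hand side is continuous, tends to \<open>0\<close> at \<open>\<infinity>\<close> and exceeds \<open>C\<close> far to the left,
  where a single summand \<open>j\<close> is already large enough.\<close>

lemma exp_sum_attains:
  fixes K e :: "'i \<Rightarrow> real" and C :: real
  assumes "finite I" "I \<noteq> {}" "\<And>i. i \<in> I \<Longrightarrow> K i > 0" "\<And>i. i \<in> I \<Longrightarrow> e i > 0" "C > 0"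
  shows "\<exists>v. (\<Sum>i\<in>I. K i * exp (- e i * v)) = C"
proof -
  let ?g = "\<lambda>v. \<Sum>i\<in>I. K i * exp (- e i * v)"
  obtain j where j: "j \<in> I" using assms by blast
  have "(?g \<longlongrightarrow> (\<Sum>i\<in>I. K i * 0)) at_top"
  proof (intro tendsto_intros)
    fix i assume "i \<in> I"
    then have "e i > 0" by (rule assms)
    then show "((\<lambda>v. exp (- e i * v)) \<longlongrightarrow> 0) at_top"
      by (intro filterlim_compose[OF exp_at_bot]
          filterlim_tendsto_neg_mult_at_bot[OF tendsto_const _ filterlim_ident]) simp
  qed
  then have "eventually (\<lambda>v. ?g v < C) at_top"
    using order_tendstoD(2)[of ?g 0 at_top C] assms(5) by simp
  then obtain v1 where v1: "v1 \<ge> 0" "?g v1 < C"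
    by (metis (no_types, lifting) eventually_at_top_linorder nle_le)
  \<comment> \<open>makes the exponent of the \<open>j\<close>-th summand equal to \<open>C / K j\<close>, and \<open>z \<le> exp z\<close>\<close>
  define v0 where "v0 = - (C / K j / e j)"
  have "C / K j \<le> exp (C / K j)" using exp_ge_add_one_self[of "C / K j"] by linarith
  then have "C \<le> K j * exp (- e j * v0)"
    using assms(3,4)[OF j] by (simp add: v0_def field_simps)
  also have "\<dots> \<le> ?g v0"
    using assms j by (intro member_le_sum) (auto intro: less_imp_le)
  finally have "C \<le> ?g v0" .
  moreover have "v0 \<le> v1" using v1 assms(3,4)[OF j] assms(5) by (simp add: v0_def order_trans[of _ 0])
  ultimately have "\<exists>v\<ge>v0. v \<le> v1 \<and> ?g v = C"
    using v1 by (intro IVT2') (auto intro!: continuous_intros)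
  then show ?thesis by blast
qed

text \<open>The hull lies between the parallel hyperplanes of coordinate sum \<open>0\<close> and \<open>v \<bullet> 1\<close>, and an
  interior point lies strictly between them; if the two coincide, there is no interior point.\<close>

lemma interior_hull_orbit:
  fixes v b :: "real ^ 'n"
  assumes b: "b \<in> interior (convex hull (sym_orbit v \<union> {0}))"
  shows "v \<bullet> 1 \<noteq> 0" and "0 < (b \<bullet> 1) / (v \<bullet> 1)" and "(b \<bullet> 1) / (v \<bullet> 1) < 1"
proof -
  let ?s = "v \<bullet> 1" and ?H = "convex hull (sym_orbit v \<union> {0})"
  have one: "(1 :: real ^ 'n) \<noteq> 0" by (simp add: vec_eq_iff)
  have sub: "?H \<subseteq> S" if "convex S" "{x. x \<bullet> 1 = ?s} \<subseteq> S" "0 \<in> S" for S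
    using that inner_one_sym_orbit[of _ v] by (intro hull_minimal) auto
  show s: "?s \<noteq> 0"
  proof
    assume "?s = 0"
    then have "?H \<subseteq> {x. 1 \<bullet> x = 0}"
      by (intro sub convex_hyperplane) (auto simp: inner_commute)
    then have "interior ?H \<subseteq> {}"
      using interior_mono interior_hyperplane[OF one, of 0] by blast
    with b show False by blast
  qed
  \<comment> \<open>scaling the normal vector by \<open>v \<bullet> 1\<close> treats both signs of \<open>v \<bullet> 1\<close> at once\<close>
  have ns: "?s *\<^sub>R 1 \<noteq> (0 :: real ^ 'n)" using s one by simp
  have "?H \<subseteq> {x. (?s *\<^sub>R 1) \<bullet> x \<le> ?s * ?s}"
    by (intro sub convex_halfspace_le) (auto simp: inner_commute)
  then have "b \<in> {x. (?s *\<^sub>R 1) \<bullet> x < ?s * ?s}"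
    using interior_mono interior_halfspace_le[OF ns] b by blast
  moreover have "?H \<subseteq> {x. (?s *\<^sub>R 1) \<bullet> x \<ge> 0}"
    by (intro sub convex_halfspace_ge) (auto simp: inner_commute)
  then have "b \<in> {x. (?s *\<^sub>R 1) \<bullet> x > 0}"
    using interior_mono interior_halfspace_ge[OF ns] b by blast
  ultimately have *: "?s * (b \<bullet> 1) < ?s * ?s" "0 < ?s * (b \<bullet> 1)"
    by (simp_all add: inner_commute)
  show "0 < (b \<bullet> 1) / ?s" using *(2) by (simp add: zero_less_divide_iff zero_less_mult_iff conj_commute)
  show "(b \<bullet> 1) / ?s < 1" using *(1) s by (auto simp: divide_less_eq mult_less_cancel_left)
qed


section \<open>Exactness of the SAGE bound\<close>

text \<open>If the coordinate sum of \<open>\<alpha>h\<close> is zero, then the orbit sums to the zero vector and adding up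
  \<open>1 + z \<le> exp z\<close> over it shows that \<open>0\<close> is a minimiser; otherwise the exponential sum tends to
  \<open>0\<close> along one direction of the diagonal and the infimum \<open>w\<close> is not attained.\<close>

lemma exact_without_negative_terms:
  fixes \<alpha>h :: "real ^ 'n"
  assumes c: "c > 0"
  shows "global_inf (\<lambda>x. c * (\<Sum>\<alpha>\<in>sym_orbit \<alpha>h. exp (\<alpha> \<bullet> x)) + w)
    = sage_bound (sym_orbit \<alpha>h \<union> {0}) (\<lambda>x. c * (\<Sum>\<alpha>\<in>sym_orbit \<alpha>h. exp (\<alpha> \<bullet> x)) + w)"
    (is "global_inf ?f = sage_bound ?T ?f")
proof -
  let ?A = "sym_orbit \<alpha>h"
  consider "\<alpha>h = 0" | "\<alpha>h \<noteq> 0" "\<alpha>h \<bullet> 1 = 0" | "\<alpha>h \<bullet> 1 \<noteq> 0" by auto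
  then show ?thesis
  proof cases
    case 1
    then have "?A = {0}"
      using self_in_sym_orbit[of "0 :: real ^ 'n"]
      by (auto simp: sym_orbit_def linear_0[OF linear_permute_coords])
    then have "(\<lambda>x. ?f x - ?f 0) = (\<lambda>x. \<Sum>\<beta>\<in>({} :: (real ^ 'n) set). (\<lambda>_. 0) x)" by auto
    also have "\<dots> \<in> C_SAGE ?T" by (rule C_SAGE_I) auto
    finally show ?thesis by (rule sage_bound_exact_at_point)
  next
    case 2
    have 0: "0 \<notin> ?A"
    proof
      assume "0 \<in> ?A"
      from sym_orbit_sym[OF this] 2(1) show False
        by (auto simp: sym_orbit_def linear_0[OF linear_permute_coords])
    qed
    \<comment> \<open>the sum of the orbit is invariant under swapping coordinates, so its coordinates agree\<close>
    have coord: "(\<Sum>\<alpha>\<in>?A. \<alpha> $ i) = (\<Sum>\<alpha>\<in>?A. \<alpha> $ j)" for i j :: 'n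
    proof -
      have p: "Transposition.transpose i j permutes UNIV" by (rule permutes_swap_id) auto
      have "(\<Sum>\<alpha>\<in>?A. \<alpha> $ i) = (\<Sum>\<alpha>\<in>?A. permute_coords (Transposition.transpose i j) \<alpha> $ i)"
        by (rule sum_sym_orbit_permute[OF p, symmetric])
      then show ?thesis by (simp add: permute_coords_def)
    qed
    have mean: "(\<Sum>\<alpha>\<in>?A. \<alpha> $ i) = 0" for i
    proof -
      have "CARD('n) * (\<Sum>\<alpha>\<in>?A. \<alpha> $ i) = (\<Sum>j\<in>UNIV. \<Sum>\<alpha>\<in>?A. \<alpha> $ j)"
        by (subst coord[of _ i]) simp
      also have "\<dots> = (\<Sum>\<alpha>\<in>?A. \<alpha> \<bullet> 1)"
        by (subst sum.swap) (simp add: inner_vec_def)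
      also have "\<dots> = 0" using 2 by (intro sum.neutral) (auto simp: inner_one_sym_orbit)
      finally show ?thesis by simp
    qed
    then have sum0: "(\<Sum>\<alpha>\<in>?A. \<alpha>) = 0" by (simp add: vec_eq_iff)
    let ?g = "\<lambda>x. (\<Sum>\<alpha>\<in>?A. c * exp (\<alpha> \<bullet> x)) + (- c * card ?A) * exp (0 \<bullet> x)"
    have nonneg: "0 \<le> ?g x" for x
    proof -
      have "0 = (\<Sum>\<alpha>\<in>?A. \<alpha>) \<bullet> x" using sum0 by simp
      also have "\<dots> = (\<Sum>\<alpha>\<in>?A. 1 + \<alpha> \<bullet> x) - card ?A"
        by (simp add: inner_sum_left sum.distrib)
      also have "\<dots> \<le> (\<Sum>\<alpha>\<in>?A. exp (\<alpha> \<bullet> x)) - card ?A"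
        by (intro diff_right_mono sum_mono exp_ge_add_one_self)
      finally have "0 \<le> c * ((\<Sum>\<alpha>\<in>?A. exp (\<alpha> \<bullet> x)) - card ?A)" using c by simp
      then show ?thesis by (simp add: sum_distrib_left algebra_simps)
    qed
    have "(\<lambda>x. ?f x - ?f 0) = (\<lambda>x. \<Sum>\<beta>\<in>{0 :: real ^ 'n}. ?g x)"
      by (simp add: sum_distrib_left)
    also have "\<dots> \<in> C_SAGE ?T"
    proof (rule C_SAGE_I)
      have "?g \<in> C_AGE (?T - {0}) 0"
        by (rule C_AGE_I) (use 0 c nonneg in auto)
      then show "?g \<in> C_AGE (?T - {\<beta>}) \<beta>" if "\<beta> \<in> {0}" for \<beta> using that by simp
    qed auto
    finally show ?thesis by (rule sage_bound_exact_at_point)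
  next
    case 3
    let ?s = "\<alpha>h \<bullet> 1"
    have 0: "0 \<notin> ?A" using 3 inner_one_sym_orbit[of 0 \<alpha>h] by auto
    let ?g = "\<lambda>x. (\<Sum>\<alpha>\<in>?A. c * exp (\<alpha> \<bullet> x)) + 0 * exp (0 \<bullet> x)"
    have "(\<lambda>x. ?f x - w) = (\<lambda>x. \<Sum>\<beta>\<in>{0 :: real ^ 'n}. ?g x)"
      by (simp add: sum_distrib_left)
    also have "\<dots> \<in> C_SAGE ?T"
    proof (rule C_SAGE_I)
      have "?g \<in> C_AGE (?T - {0}) 0"
        by (rule C_AGE_I) (use 0 c in \<open>auto intro: sum_nonneg\<close>)
      then show "?g \<in> C_AGE (?T - {\<beta>}) \<beta>" if "\<beta> \<in> {0}" for \<beta> using that by simp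
    qed auto
    finally have lower: "ereal w \<le> sage_bound ?T ?f"
      unfolding sage_bound_def by (intro SUP_upper) simp
    have lim: "((\<lambda>t. ereal (c * (card ?A * exp t) + w)) \<longlongrightarrow> ereal (c * (real (card ?A) * 0) + w)) at_bot"
      by (intro tendsto_intros exp_at_bot)
    have "global_inf ?f \<le> ereal (c * (card ?A * exp t) + w)" for t
    proof -
      have "?f ((t / ?s) *\<^sub>R 1) = c * (card ?A * exp t) + w"
        using 3 by (simp add: inner_one_sym_orbit)
      moreover have "global_inf ?f \<le> ereal (?f ((t / ?s) *\<^sub>R 1))"
        unfolding global_inf_def by (rule INF_lower) simp
      ultimately show ?thesis by metis
    qed
    then have "global_inf ?f \<le> ereal w"
      using tendsto_lowerbound[OF lim, of "global_inf ?f"] by simp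
    with lower have "global_inf ?f \<le> sage_bound ?T ?f" by order
    then show ?thesis using sage_bound_le_global_inf[of ?T ?f] by simp
  qed
qed

text \<open>The point \<open>x0\<close> below lies on the diagonal, where all exponents of one orbit take the same
  value: \<open>\<alpha> \<bullet> x0 = v\<close> on \<open>A\<close> and \<open>\<beta> \<bullet> x0 = \<theta> i * v\<close> on \<open>B i\<close>.\<close>

lemma exact_with_negative_terms:
  fixes \<alpha>h :: "real ^ 'n" and \<beta>h :: "'i \<Rightarrow> real ^ 'n" and d :: "'i \<Rightarrow> real"
    and c w :: real and I :: "'i set"
  defines "A \<equiv> sym_orbit \<alpha>h" and "B \<equiv> \<lambda>i. sym_orbit (\<beta>h i)"
  defines "f \<equiv> \<lambda>x. c * (\<Sum>\<alpha>\<in>A. exp (\<alpha> \<bullet> x)) - (\<Sum>i\<in>I. d i * (\<Sum>\<beta>\<in>B i. exp (\<beta> \<bullet> x))) + w"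
  assumes I: "finite I" "I \<noteq> {}"
    and interior: "\<And>i. i \<in> I \<Longrightarrow> \<beta>h i \<in> interior (convex hull (A \<union> {0}))"
    and distinct_orbits: "\<And>i j. i \<in> I \<Longrightarrow> j \<in> I \<Longrightarrow> i \<noteq> j \<Longrightarrow> B i \<noteq> B j"
    and c: "c > 0" and d: "\<And>i. i \<in> I \<Longrightarrow> d i > 0"
  shows "global_inf f = sage_bound (A \<union> (\<Union>i\<in>I. B i) \<union> {0}) f"
proof -
  let ?T = "A \<union> (\<Union>i\<in>I. B i) \<union> {0}"
  define s where "s = \<alpha>h \<bullet> 1"
  define \<theta> where "\<theta> i = (\<beta>h i \<bullet> 1) / s" for i
  have s: "s \<noteq> 0" and \<theta>: "\<And>i. i \<in> I \<Longrightarrow> 0 < \<theta> i" "\<And>i. i \<in> I \<Longrightarrow> \<theta> i < 1"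
    using interior_hull_orbit[OF interior[unfolded A_def]] I(2) unfolding s_def \<theta>_def by blast+
  have A1: "a \<bullet> 1 = s" if "a \<in> A" for a
    using that by (simp add: A_def s_def inner_one_sym_orbit)
  have B1: "b \<bullet> 1 = \<theta> i * s" if "b \<in> B i" for b i
    using that s by (simp add: B_def \<theta>_def inner_one_sym_orbit)
  have finA [simp]: "finite A" and finB [simp]: "\<And>i. finite (B i)" by (simp_all add: A_def B_def)
  have cA: "card A > 0" and cB: "\<And>i. card (B i) > 0" by (simp_all add: A_def B_def card_sym_orbit_pos)
  have 0: "0 \<notin> A" using A1 s by force
  have B_sep: "b \<notin> A" "b \<noteq> 0" if "i \<in> I" "b \<in> B i" for i b
    using A1[of b] B1[OF that(2)] s \<theta>[OF that(1)] by auto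
  have B_disj: "B i \<inter> B j = {}" if "i \<in> I" "j \<in> I" "i \<noteq> j" for i j
    using distinct_orbits[OF that] sym_orbit_eqI unfolding B_def by blast
  \<comment> \<open>the orbits \<open>B i\<close> are disjoint, so an exponent determines its index and the double sum over
      \<open>i\<close> and \<open>B i\<close> is a single sum over exponents, as the definition of the cone requires\<close>
  obtain ix where ix: "\<And>i b. i \<in> I \<Longrightarrow> b \<in> B i \<Longrightarrow> ix b = i"
  proof
    fix i b assume "i \<in> I" "b \<in> B i"
    with B_disj show "(SOME i. i \<in> I \<and> b \<in> B i) = i" by (intro some_equality) blast+
  qed

  obtain v where v: "(\<Sum>i\<in>I. (d i * card (B i) * \<theta> i) * exp (- (1 - \<theta> i) * v)) = c * card A"
    using exp_sum_attains[of I "\<lambda>i. d i * card (B i) * \<theta> i" "\<lambda>i. 1 - \<theta> i" "c * card A"]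
      I c cA cB d \<theta> by auto
  define x0 :: "real ^ 'n" where "x0 = (v / s) *\<^sub>R 1"
  have A_x0: "a \<bullet> x0 = v" if "a \<in> A" for a using A1[OF that] s by (simp add: x0_def)
  have B_x0: "b \<bullet> x0 = \<theta> i * v" if "b \<in> B i" for b i using B1[OF that] s by (simp add: x0_def)

  have "\<forall>i\<in>I. \<exists>\<nu> :: real ^ 'n \<Rightarrow> real ^ 'n \<Rightarrow> real. (\<forall>b\<in>B i. (\<forall>a\<in>A. 0 \<le> \<nu> b a) \<and> (\<Sum>a\<in>A. \<nu> b a *\<^sub>R a) = b \<and> (\<Sum>a\<in>A. \<nu> b a) = \<theta> i) \<and>
      (\<forall>a\<in>A. card A * (\<Sum>b\<in>B i. \<nu> b a) = \<theta> i * card (B i))"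
    unfolding A_def B_def
    by (intro ballI balanced_weights)
       (use s interior interior_subset in \<open>auto simp: s_def \<theta>_def A_def\<close>)
  from bchoice[OF this] obtain \<nu> :: "'i \<Rightarrow> real ^ 'n \<Rightarrow> real ^ 'n \<Rightarrow> real" where
    "\<forall>i\<in>I. (\<forall>b\<in>B i. (\<forall>a\<in>A. 0 \<le> \<nu> i b a) \<and> (\<Sum>a\<in>A. \<nu> i b a *\<^sub>R a) = b \<and> (\<Sum>a\<in>A. \<nu> i b a) = \<theta> i) \<and>
      (\<forall>a\<in>A. card A * (\<Sum>b\<in>B i. \<nu> i b a) = \<theta> i * card (B i))" by blast
  then have \<nu>: "\<And>i b a. i \<in> I \<Longrightarrow> b \<in> B i \<Longrightarrow> a \<in> A \<Longrightarrow> 0 \<le> \<nu> i b a"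
    "\<And>i b. i \<in> I \<Longrightarrow> b \<in> B i \<Longrightarrow> (\<Sum>a\<in>A. \<nu> i b a *\<^sub>R a) = b"
    "\<And>i b. i \<in> I \<Longrightarrow> b \<in> B i \<Longrightarrow> (\<Sum>a\<in>A. \<nu> i b a) = \<theta> i"
    "\<And>i a. i \<in> I \<Longrightarrow> a \<in> A \<Longrightarrow> card A * (\<Sum>b\<in>B i. \<nu> i b a) = \<theta> i * card (B i)"
    by blast+

  \<comment> \<open>coefficients of the AM/GM inequality for \<open>b\<close> after translating it to be tight at \<open>x0\<close>:
      \<open>d i * exp (b \<bullet> x0)\<close> times the weight, divided by the value of the exponential at \<open>x0\<close>\<close>
  define k where "k i b a = (if a = 0 then d i * (1 - \<theta> i) * exp (\<theta> i * v)
    else d i * \<nu> i b a * exp (- (1 - \<theta> i) * v))" for i b a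
  define h where "h i b x = (\<Sum>a\<in>insert 0 A. k i b a * exp (a \<bullet> x)) + (- d i) * exp (b \<bullet> x)" for i b x
  have h_eq: "h i b x = d i * exp (- (1 - \<theta> i) * v) * (\<Sum>a\<in>A. \<nu> i b a * exp (a \<bullet> x))
      + d i * (1 - \<theta> i) * exp (\<theta> i * v) - d i * exp (b \<bullet> x)" for i b x
  proof -
    have "(\<Sum>a\<in>A. k i b a * exp (a \<bullet> x)) = (\<Sum>a\<in>A. d i * exp (- (1 - \<theta> i) * v) * (\<nu> i b a * exp (a \<bullet> x)))"
      using 0 by (intro sum.cong) (auto simp: k_def)
    then show ?thesis using 0 by (simp add: h_def k_def sum_distrib_left)
  qed
  have h_shift: "h i b x = d i * exp (\<theta> i * v) *
      ((\<Sum>a\<in>A. \<nu> i b a * exp (a \<bullet> (x - x0))) + (1 - \<theta> i) - exp (b \<bullet> (x - x0)))"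
    if b: "b \<in> B i" for i b x
  proof -
    have "exp (- (1 - \<theta> i) * v) * (\<Sum>a\<in>A. \<nu> i b a * exp (a \<bullet> x))
        = exp (\<theta> i * v) * (\<Sum>a\<in>A. \<nu> i b a * exp (a \<bullet> (x - x0)))"
      unfolding sum_distrib_left
      by (intro sum.cong refl) (simp add: A_x0 inner_diff_right exp_diff algebra_simps exp_minus field_simps)
    moreover have "exp (b \<bullet> x) = exp (\<theta> i * v) * exp (b \<bullet> (x - x0))"
      by (simp add: B_x0[OF b] inner_diff_right flip: exp_add)
    ultimately show ?thesis unfolding h_eq by (simp add: algebra_simps)
  qed
  have h_nonneg: "0 \<le> h i b x" if "i \<in> I" "b \<in> B i" for i b x
    unfolding h_shift[OF that(2)]
    using weighted_exp_le[OF \<nu>(1,2)[OF that], of "x - x0"] \<theta>[OF that(1)] d[OF that(1)] \<nu>(3)[OF that]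
    by (intro mult_nonneg_nonneg) auto
  have h_zero: "h i b x0 = 0" if "i \<in> I" "b \<in> B i" for i b
    unfolding h_shift[OF that(2)] by (simp add: \<nu>(3)[OF that])
  have h_AGE: "h i b \<in> C_AGE (?T - {b}) b" if "i \<in> I" "b \<in> B i" for i b
    unfolding h_def[abs_def]
  proof (rule C_AGE_I)
    show "insert 0 A \<subseteq> ?T - {b}" using B_sep[OF that] by auto
    show "0 \<le> k i b a" if "a \<in> insert 0 A" for a
      using that \<theta>[OF \<open>i \<in> I\<close>] d[OF \<open>i \<in> I\<close>] \<nu>(1)[OF \<open>i \<in> I\<close> \<open>b \<in> B i\<close>] by (auto simp: k_def)
    show "0 \<le> (\<Sum>a\<in>insert 0 A. k i b a * exp (a \<bullet> x)) + - d i * exp (b \<bullet> x)" for x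
      using h_nonneg[OF that] by (simp add: h_def)
  qed (use I in auto)

  define W where "W = (\<Sum>i\<in>I. card (B i) * (d i * (1 - \<theta> i) * exp (\<theta> i * v)))"
  have sum_h: "(\<Sum>i\<in>I. \<Sum>b\<in>B i. h i b x) = f x - w + W" for x
  proof -
    let ?e = "\<lambda>i. d i * exp (- (1 - \<theta> i) * v)"
    have inner: "(\<Sum>b\<in>B i. \<Sum>a\<in>A. \<nu> i b a * exp (a \<bullet> x))
        = \<theta> i * card (B i) / card A * (\<Sum>a\<in>A. exp (a \<bullet> x))" if "i \<in> I" for i
    proof -
      have "(\<Sum>b\<in>B i. \<nu> i b a) = \<theta> i * card (B i) / card A" if "a \<in> A" for a
        using \<nu>(4)[OF \<open>i \<in> I\<close> that] cA by (auto simp: eq_divide_eq mult.commute)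
      then show ?thesis
        by (subst sum.swap) (simp add: sum_distrib_left flip: sum_distrib_right)
    qed
    have "(\<Sum>b\<in>B i. h i b x) = ?e i * (\<theta> i * card (B i) / card A * (\<Sum>a\<in>A. exp (a \<bullet> x)))
        + card (B i) * (d i * (1 - \<theta> i) * exp (\<theta> i * v)) - d i * (\<Sum>b\<in>B i. exp (b \<bullet> x))" if "i \<in> I" for i
      unfolding h_eq inner[OF that, symmetric]
      by (simp add: sum.distrib sum_subtractf sum_distrib_left)
    then have "(\<Sum>i\<in>I. \<Sum>b\<in>B i. h i b x)
        = (\<Sum>i\<in>I. ?e i * (\<theta> i * card (B i) / card A * (\<Sum>a\<in>A. exp (a \<bullet> x))))
          + W - (\<Sum>i\<in>I. d i * (\<Sum>b\<in>B i. exp (b \<bullet> x)))"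
      by (simp add: W_def sum.distrib sum_subtractf)
    also have "(\<Sum>i\<in>I. ?e i * (\<theta> i * card (B i) / card A * (\<Sum>a\<in>A. exp (a \<bullet> x))))
        = (\<Sum>i\<in>I. (d i * card (B i) * \<theta> i) * exp (- (1 - \<theta> i) * v)) / card A * (\<Sum>a\<in>A. exp (a \<bullet> x))"
      unfolding sum_divide_distrib sum_distrib_right[where A = I]
      by (intro sum.cong refl) (simp add: mult_ac)
    also have "\<dots> = c * (\<Sum>a\<in>A. exp (a \<bullet> x))" using v cA by simp
    finally show ?thesis by (simp add: f_def)
  qed
  have "f x0 = w - W" using sum_h[of x0] h_zero by simp
  then have "(\<lambda>x. f x - f x0) = (\<lambda>x. \<Sum>i\<in>I. \<Sum>b\<in>B i. h i b x)" by (intro ext) (simp add: sum_h)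
  also have "\<dots> = (\<lambda>x. \<Sum>b\<in>(\<Union>i\<in>I. B i). h (ix b) b x)"
    using I B_disj by (subst sum.UNION_disjoint) (auto simp: ix)
  also have "\<dots> \<in> C_SAGE ?T"
    by (rule C_SAGE_I) (use I h_AGE ix in auto)
  finally show ?thesis by (rule sage_bound_exact_at_point)
qed

theorem theorem4p1:
  fixes \<alpha>h :: "real ^ 'n" and \<beta>h :: "nat \<Rightarrow> real ^ 'n" and m :: nat
    and c w :: real and d :: "nat \<Rightarrow> real"
    and A :: "(real ^ 'n) set" and B :: "nat \<Rightarrow> (real ^ 'n) set"
    and f :: "real ^ 'n \<Rightarrow> real"
  assumes A: "A = sym_orbit \<alpha>h"
    and interior: "\<And>i. i \<in> {1..m} \<Longrightarrow> \<beta>h i \<in> interior (convex hull (A \<union> {0}))"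
    and B: "\<And>i. i \<in> {1..m} \<Longrightarrow> B i = sym_orbit (\<beta>h i)"
    and distinct_orbits:
      "\<And>i j. i \<in> {1..m} \<Longrightarrow> j \<in> {1..m} \<Longrightarrow> i \<noteq> j \<Longrightarrow> sym_orbit (\<beta>h i) \<noteq> sym_orbit (\<beta>h j)"
    and c: "c > 0"
    and d: "\<And>i. i \<in> {1..m} \<Longrightarrow> d i > 0"
    and f: "\<And>x. f x = c * (\<Sum>\<alpha>\<in>A. exp (\<alpha> \<bullet> x))
                    - (\<Sum>i=1..m. d i * (\<Sum>\<beta>\<in>B i. exp (\<beta> \<bullet> x))) + w"
  shows "global_inf f = sage_bound (A \<union> (\<Union>i\<in>{1..m}. B i) \<union> {0}) f"
proof (cases "m = 0")
  case True
  then have "f = (\<lambda>x. c * (\<Sum>\<alpha>\<in>sym_orbit \<alpha>h. exp (\<alpha> \<bullet> x)) + w)" using f A by auto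
  with True exact_without_negative_terms[OF c, of \<alpha>h w] A show ?thesis by simp
next
  case False
  have f': "f = (\<lambda>x. c * (\<Sum>\<alpha>\<in>sym_orbit \<alpha>h. exp (\<alpha> \<bullet> x))
      - (\<Sum>i=1..m. d i * (\<Sum>\<beta>\<in>sym_orbit (\<beta>h i). exp (\<beta> \<bullet> x))) + w)"
    by (rule ext) (simp add: f A B)
  have T: "A \<union> (\<Union>i\<in>{1..m}. B i) \<union> {0} = sym_orbit \<alpha>h \<union> (\<Union>i\<in>{1..m}. sym_orbit (\<beta>h i)) \<union> {0}"
    using A B by auto
  show ?thesis unfolding T f'
    by (rule exact_with_negative_terms)
       (use False interior distinct_orbits c d in \<open>auto simp: A\<close>)
qed

end
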